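(* Let $d\ge 2$ and let $\pi_1,\dots,\pi_d:[n]\to[n]$ be permutations. Let $G_1=([n],E_1)$ be the directed multi-graph with $E_1=\{(v,\pi_i(v)):v\in[n],i\in[d]\}$, where the edge $(v,\pi_i(v))$ has colour $i$, and let $G_2=(V_2,E_2)$ be the undirected multi-graph with $V_2=\{(u,v)\in[n]^2:u\ne v\}$ and $E_2=\{\{(u,v),(\pi_i(u),\pi_i(v))\}:(u,v)\in V_2,i\in[d]\}$. If $G_2$ is $\gamma$-expanding, then the edge-coloured directed multi-graph $G_1$ is $\gamma$-robustly self-ordered. Furthermore, the undirected multi-graph underlying $G_1$ is $\min(0.25,\gamma/3)$-expanding.
   Context: A multi-graph $G=(V,E)$ is $\gamma$-expanding if for every $S\subseteq V$ with $|S|\le|V|/2$, at least $\gamma|S|$ vertices in $V\setminus S$ neighbour some vertex of $S$. For an edge-coloured directed multi-graph $G=(V,E)$ with $E_i$ the multi-set of (directed) edges of colour $i$, and a permutation $\mu$ of $V$, let $\mu(E_i)=\{(\mu(u),\mu(v)):(u,v)\in E_i\}$ (as multi-sets). $G$ is $\gamma$-robustly self-ordered if for every permutation $\mu:V\to V$, $\sum_i|E_i\triangle\mu(E_i)|\ge\gamma\cdot|\{v\in V:\mu(v)\ne v\}|$, where the multi-set symmetric difference counts each element with multiplicity equal to the absolute difference of its multiplicities.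
   Formalization: The robust self-ordering conclusion is stated only for n ≠ 2, since it fails for n = 2 (take all π_i equal to the transposition: G_2 is 1-expanding, but the transposition is a nontrivial automorphism of G_1); the expansion claim is for all n. *)

theory Defs
  imports Complex_Main "HOL-Library.Multiset" "HOL-Library.Uprod" "HOL-Combinatorics.Permutations"
begin

text \<open>
  An undirected multi-graph is given by a vertex set and a multi-set of unordered pairs
  (\<^typ>\<open>'a uprod\<close> allows loops). An edge-coloured directed multi-graph is given by a vertex set
  and a multi-set of pairs (directed edge, colour). Vertex sets are meant to be finite.
\<close>

definition expanding :: "real \<Rightarrow> 'a set \<Rightarrow> 'a uprod multiset \<Rightarrow> bool" where
  "expanding \<gamma> V E \<longleftrightarrow>
     (\<forall>S\<subseteq>V. real (card S) \<le> real (card V) / 2 \<longrightarrow>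
        real (card {v \<in> V - S. \<exists>u\<in>S. Upair u v \<in># E}) \<ge> \<gamma> * real (card S))"

definition mset_sym_diff :: "'a multiset \<Rightarrow> 'a multiset \<Rightarrow> 'a multiset" where
  "mset_sym_diff A B = (A - B) + (B - A)"

lemma count_mset_sym_diff:
  "int (count (mset_sym_diff A B) x) = \<bar>int (count A x) - int (count B x)\<bar>"
  by (simp add: mset_sym_diff_def)

definition colour_class :: "'c \<Rightarrow> (('a \<times> 'a) \<times> 'c) multiset \<Rightarrow> ('a \<times> 'a) multiset" where
  "colour_class i E = image_mset fst (filter_mset (\<lambda>e. snd e = i) E)"

text \<open>The sum ranges over the colours that occur in \<open>E\<close>; any other colour contributes 0.\<close>

definition robustly_self_ordered :: "real \<Rightarrow> 'a set \<Rightarrow> (('a \<times> 'a) \<times> 'c) multiset \<Rightarrow> bool" where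
  "robustly_self_ordered \<gamma> V E \<longleftrightarrow>
     (\<forall>\<mu>. \<mu> permutes V \<longrightarrow>
        real (\<Sum>i\<in>snd ` set_mset E.
          size (mset_sym_diff (colour_class i E) (image_mset (map_prod \<mu> \<mu>) (colour_class i E))))
        \<ge> \<gamma> * real (card {v \<in> V. \<mu> v \<noteq> v}))"

definition underlying :: "(('a \<times> 'a) \<times> 'c) multiset \<Rightarrow> 'a uprod multiset" where
  "underlying E = image_mset (\<lambda>((u, v), i). Upair u v) E"

definition E1 :: "nat \<Rightarrow> nat \<Rightarrow> (nat \<Rightarrow> nat \<Rightarrow> nat) \<Rightarrow> ((nat \<times> nat) \<times> nat) multiset" where
  "E1 n d \<pi> = image_mset (\<lambda>(v, i). ((v, \<pi> i v), i)) (mset_set ({1..n} \<times> {1..d}))"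

definition V2 :: "nat \<Rightarrow> (nat \<times> nat) set" where
  "V2 n = {(u, v) \<in> {1..n} \<times> {1..n}. u \<noteq> v}"

definition E2 :: "nat \<Rightarrow> nat \<Rightarrow> (nat \<Rightarrow> nat \<Rightarrow> nat) \<Rightarrow> (nat \<times> nat) uprod multiset" where
  "E2 n d \<pi> =
     image_mset (\<lambda>((u, v), i). Upair (u, v) (\<pi> i u, \<pi> i v)) (mset_set (V2 n \<times> {1..d}))"

text \<open>
  The case \<open>n = 2\<close> has to be excluded from robust self-ordering: if all \<open>\<pi> i\<close> are the transposition
  of 1 and 2, then \<open>(V2 2, E2 2 d \<pi>)\<close> is 1-expanding, but the transposition is a nontrivial
  automorphism of the coloured digraph. For \<open>n \<noteq> 2\<close> one has \<open>n \<le> card (V2 n) / 2\<close> or \<open>n \<le> 1\<close>, so the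
  set of pairs \<open>(v, \<mu> v)\<close> with \<open>\<mu> v \<noteq> v\<close> is always small enough to expand.
\<close>

end

theory Submission imports Defs
begin

text \<open>
  For a permutation \<open>\<mu>\<close> apply the expansion of \<open>G\<^sub>2\<close> to the set \<open>T\<close> of pairs \<open>(v, \<mu> v)\<close> with \<open>\<mu> v \<noteq> v\<close>.
  An edge of colour \<open>i\<close> leaves \<open>T\<close> only where \<open>\<pi> i\<close> and \<open>\<mu>\<close> fail to commute, and each such failure
  accounts for at most two boundary vertices of \<open>T\<close> (one in each direction) and exactly two elements
  of the symmetric difference of \<open>E\<^sub>i\<close> and \<open>\<mu>(E\<^sub>i)\<close>.

  For the underlying graph, apply the expansion of \<open>G\<^sub>2\<close> to the set of all pairs with first component
  in \<open>S\<close>: both this set and its boundary fibre over \<open>[n]\<close> with fibres of size \<open>n - 1\<close>, so \<open>G\<^sub>1\<close> is even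
  \<open>\<gamma>\<close>-expanding.
\<close>

text \<open>Edges are unordered, so \<open>p\<close> can be the tail or the head of the step by
  \<open>\<pi> i\<close>; the two cases later give the two kinds of boundary vertices.\<close>

lemma Upair_in_E2_iff:
  "Upair p q \<in># E2 n d \<pi> \<longleftrightarrow>
     (\<exists>i\<in>{1..d}. p \<in> V2 n \<and> q = map_prod (\<pi> i) (\<pi> i) p \<or> q \<in> V2 n \<and> p = map_prod (\<pi> i) (\<pi> i) q)"
proof -
  have "finite (V2 n)"
    by (rule finite_subset[of _ "{1..n} \<times> {1..n}"]) (auto simp: V2_def)
  then have "Upair p q \<in># E2 n d \<pi> \<longleftrightarrow>
      (\<exists>r\<in>V2 n. \<exists>i\<in>{1..d}. Upair p q = Upair r (map_prod (\<pi> i) (\<pi> i) r))"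
    by (simp add: E2_def image_iff split_beta map_prod_def)
  then show ?thesis
    unfolding Upair_inject by blast
qed

lemma Upair_in_underlying_E1_iff:
  "Upair u v \<in># underlying (E1 n d \<pi>) \<longleftrightarrow>
     (\<exists>i\<in>{1..d}. u \<in> {1..n} \<and> v = \<pi> i u \<or> v \<in> {1..n} \<and> u = \<pi> i v)"
  by (auto simp: underlying_def E1_def image_iff Bex_def)

lemma set_colour_class_E1:
  "i \<in> {1..d} \<Longrightarrow> set_mset (colour_class i (E1 n d \<pi>)) = (\<lambda>v. (v, \<pi> i v)) ` {1..n}"
  by (auto simp: colour_class_def E1_def image_iff Bex_def)

lemma colours_E1: "n \<noteq> 0 \<Longrightarrow> snd ` set_mset (E1 n d \<pi>) = {1..d}"
  by (force simp: E1_def image_iff)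

lemma card_set_mset_le_size: "card (set_mset M) \<le> size M"
  by (metis mset_set_set_mset_msubset size_mset_mono size_mset_set)

text \<open>Each fibre loses only its diagonal point. This counts \<open>V2 n\<close> itself, the
  pairs over a set \<open>S\<close>, and the pairs over the boundary of \<open>S\<close>.\<close>

lemma card_Sigma_diff_single:
  assumes "S \<subseteq> {1..n::nat}"
  shows "card (SIGMA u:S. {1..n} - {u}) = card S * (n - 1)"
proof -
  have "finite S" using assms finite_subset by blast
  then have "card (SIGMA u:S. {1..n} - {u}) = (\<Sum>u\<in>S. card ({1..n} - {u}))"
    by simp
  also have "\<dots> = (\<Sum>u\<in>S. n - 1)"
    using assms by (intro sum.cong) auto
  finally show ?thesis by simp
qed

lemma V2_eq_Sigma: "V2 n = (SIGMA u:{1..n}. {1..n} - {u})"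
  by (auto simp: V2_def)

lemma card_V2: "card (V2 n) = n * (n - 1)"
  using card_Sigma_diff_single[of "{1..n}" n] by (simp add: V2_eq_Sigma)

text \<open>For \<open>v\<close> in \<open>{1..n}\<close>, exactly one edge of each of the two
  multi-sets leaves \<open>\<mu> v\<close>: it ends at \<open>\<pi> i (\<mu> v)\<close> in one and
  at \<open>\<mu> (\<pi> i v)\<close> in the other. Where these ends differ, both edges survive in
  the symmetric difference.\<close>

lemma size_sym_diff_colour_class_ge:
  assumes i: "i \<in> {1..d}" and \<pi>: "\<pi> i permutes {1..n}" and \<mu>: "\<mu> permutes {1..n}"
  shows "2 * card {v \<in> {1..n}. \<pi> i (\<mu> v) \<noteq> \<mu> (\<pi> i v)} \<le>
    size (mset_sym_diff (colour_class i (E1 n d \<pi>))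
      (image_mset (map_prod \<mu> \<mu>) (colour_class i (E1 n d \<pi>))))"
    (is "2 * card ?B \<le> size (mset_sym_diff ?C ?C')")
proof -
  have C: "set_mset ?C = (\<lambda>v. (v, \<pi> i v)) ` {1..n}"
    by (rule set_colour_class_E1[OF i])
  have C': "set_mset ?C' = (\<lambda>v. (\<mu> v, \<mu> (\<pi> i v))) ` {1..n}"
    by (simp add: C image_image)
  have inj: "\<mu> u = \<mu> v \<longleftrightarrow> u = v" for u v
    using permutes_inj[OF \<mu>] by (simp add: inj_eq)
  have in_diff: "x \<in># M - N" if "x \<in># M" "x \<notin># N" for x :: "nat \<times> nat" and M N
    using that by (simp add: in_diff_count not_in_iff)
  have "card ?B \<le> size (?C - ?C')"
  proof -
    have "(\<lambda>v. (\<mu> v, \<pi> i (\<mu> v))) ` ?B \<subseteq> set_mset (?C - ?C')"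
    proof (intro image_subsetI in_diff)
      fix v assume v: "v \<in> ?B"
      then show "(\<mu> v, \<pi> i (\<mu> v)) \<in># ?C"
        using permutes_in_image[OF \<mu>, of v] unfolding C by blast
      show "(\<mu> v, \<pi> i (\<mu> v)) \<notin># ?C'"
        unfolding C' using v by (auto simp: inj)
    qed
    then have "card ((\<lambda>v. (\<mu> v, \<pi> i (\<mu> v))) ` ?B) \<le> size (?C - ?C')"
      by (meson card_mono card_set_mset_le_size finite_set_mset le_trans)
    then show ?thesis
      by (subst (asm) card_image) (auto simp: inj_on_def inj)
  qed
  moreover have "card ?B \<le> size (?C' - ?C)"
  proof -
    have "(\<lambda>v. (\<mu> v, \<mu> (\<pi> i v))) ` ?B \<subseteq> set_mset (?C' - ?C)"
    proof (intro image_subsetI in_diff)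
      fix v assume v: "v \<in> ?B"
      then show "(\<mu> v, \<mu> (\<pi> i v)) \<in># ?C'"
        by (auto simp only: C')
      show "(\<mu> v, \<mu> (\<pi> i v)) \<notin># ?C"
        unfolding C using v by auto
    qed
    then have "card ((\<lambda>v. (\<mu> v, \<mu> (\<pi> i v))) ` ?B) \<le> size (?C' - ?C)"
      by (meson card_mono card_set_mset_le_size finite_set_mset le_trans)
    then show ?thesis
      by (subst (asm) card_image) (auto simp: inj_on_def inj)
  qed
  ultimately show ?thesis
    by (simp add: mset_sym_diff_def)
qed

lemma robustly_self_ordered_E1:
  assumes \<pi>: "\<And>i. i \<in> {1..d} \<Longrightarrow> \<pi> i permutes {1..n}"
    and exp: "expanding \<gamma> (V2 n) (E2 n d \<pi>)" and "n \<noteq> 2"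
  shows "robustly_self_ordered \<gamma> {1..n} (E1 n d \<pi>)"
  unfolding robustly_self_ordered_def
proof (intro allI impI)
  fix \<mu> assume \<mu>: "\<mu> permutes {1..n}"
  define A where "A = {v \<in> {1..n}. \<mu> v \<noteq> v}"
  define D where "D i = size (mset_sym_diff (colour_class i (E1 n d \<pi>))
      (image_mset (map_prod \<mu> \<mu>) (colour_class i (E1 n d \<pi>))))" for i
  have "real (\<Sum>i\<in>snd ` set_mset (E1 n d \<pi>). D i) \<ge> \<gamma> * real (card A)"
  proof (cases "A = {}")
    case True
    then show ?thesis by (simp add: sum_nonneg)
  next
    case False
    then obtain v where v: "v \<in> {1..n}" "\<mu> v \<noteq> v" by (auto simp: A_def)
    then have "\<mu> v \<in> {1..n}" using permutes_in_image[OF \<mu>] by blast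
    \<comment> \<open>The distinct points \<open>v\<close> and \<open>\<mu> v\<close> give
      \<open>n \<ge> 2\<close>.\<close>
    then have n: "n \<ge> 3" using v \<open>n \<noteq> 2\<close> by auto
    define T where "T = (\<lambda>v. (v, \<mu> v)) ` A"
    define B where "B i = {v \<in> {1..n}. \<pi> i (\<mu> v) \<noteq> \<mu> (\<pi> i v)}" for i
    \<comment> \<open>First image: ends of edges that start in \<open>T\<close>. Second image:
      starts of edges that end in \<open>T\<close>, where \<open>(\<pi> i x, \<pi> i y)\<close> in
      \<open>T\<close> forces the value of \<open>y\<close>.\<close>
    define R where "R i = (\<lambda>u. (\<pi> i u, \<pi> i (\<mu> u))) ` B i \<union> (\<lambda>x. (x, inv (\<pi> i) (\<mu> (\<pi> i x)))) ` B i" for i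
    define N where "N = {q \<in> V2 n - T. \<exists>p\<in>T. Upair p q \<in># E2 n d \<pi>}"
    have T: "T \<subseteq> V2 n"
      by (auto simp: T_def A_def V2_eq_Sigma permutes_in_image[OF \<mu>] simp del: atLeastAtMost_iff One_nat_def)
    have card_T: "card T = card A"
      unfolding T_def by (rule card_image) (auto simp: inj_on_def)
    have "card A \<le> n"
      using card_mono[of "{1..n}" A] by (simp add: A_def subset_iff)
    \<comment> \<open>This is where \<open>n - 1 \<ge> 2\<close> enters: \<open>T\<close> has at
      most \<open>n\<close> elements, and \<open>V2 n\<close> has
      \<open>n * (n - 1)\<close>.\<close>
    moreover have "n * 2 \<le> card (V2 n)"
      using n unfolding card_V2 by (intro mult_left_mono) auto
    ultimately have "real (card T) \<le> real (card (V2 n)) / 2"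
      unfolding card_T by linarith
    then have N: "\<gamma> * real (card A) \<le> real (card N)"
      using exp T unfolding expanding_def N_def card_T[symmetric] by blast
    have "N \<subseteq> (\<Union>i\<in>{1..d}. R i)"
    proof
      fix q assume q: "q \<in> N"
      obtain x y where xy: "q = (x, y)" by (cases q)
      \<comment> \<open>If \<open>y = \<mu> x\<close>, then \<open>x \<noteq> y\<close> would put
        \<open>x\<close> into \<open>A\<close> and \<open>q\<close> into \<open>T\<close>.\<close>
      from q xy have V: "x \<in> {1..n}" "y \<in> {1..n}" "x \<noteq> y" and nT: "y \<noteq> \<mu> x"
        by (auto simp: N_def V2_def T_def A_def)
      from q obtain u i where u: "u \<in> A" and i: "i \<in> {1..d}"
        and e: "q = (\<pi> i u, \<pi> i (\<mu> u)) \<or> (u, \<mu> u) = (\<pi> i x, \<pi> i y)"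
        by (auto simp: N_def T_def Upair_in_E2_iff xy)
      from e have "q \<in> R i"
      proof
        assume "q = (\<pi> i u, \<pi> i (\<mu> u))"
        with u nT xy show ?thesis by (auto simp: R_def B_def A_def)
      next
        assume a: "(u, \<mu> u) = (\<pi> i x, \<pi> i y)"
        have inj: "inj (\<pi> i)" using permutes_inj[OF \<pi>[OF i]] .
        have "y = inv (\<pi> i) (\<mu> (\<pi> i x))"
          using a by (metis Pair_inject inj inv_f_f)
        \<comment> \<open>Since \<open>\<mu> (\<pi> i x) = \<pi> i y\<close>, commuting at
          \<open>x\<close> would give \<open>y = \<mu> x\<close> by injectivity.\<close>
        moreover have "\<pi> i (\<mu> x) \<noteq> \<mu> (\<pi> i x)"
          using a nT by (metis Pair_inject inj inj_eq)
        ultimately show ?thesis using V xy by (auto simp: R_def B_def)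
      qed
      with i show "q \<in> (\<Union>i\<in>{1..d}. R i)"
        by blast
    qed
    then have "card N \<le> card (\<Union>i\<in>{1..d}. R i)"
      by (rule card_mono[rotated]) (auto simp: R_def B_def)
    also have "\<dots> \<le> (\<Sum>i\<in>{1..d}. card (R i))"
      by (rule card_UN_le) simp
    also have "\<dots> \<le> (\<Sum>i\<in>{1..d}. 2 * card (B i))"
    proof (rule sum_mono)
      fix i
      have "finite (B i)" by (simp add: B_def)
      then show "card (R i) \<le> 2 * card (B i)"
        unfolding R_def by (intro order.trans[OF card_Un_le]) (simp add: mult_2 add_mono card_image_le)
    qed
    also have "\<dots> \<le> (\<Sum>i\<in>{1..d}. D i)"
      unfolding B_def D_def by (intro sum_mono size_sym_diff_colour_class_ge \<pi> \<mu>)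
    also have "\<dots> = (\<Sum>i\<in>snd ` set_mset (E1 n d \<pi>). D i)"
      using n by (simp add: colours_E1)
    finally show ?thesis using N by linarith
  qed
  then show "real (\<Sum>i\<in>snd ` set_mset (E1 n d \<pi>).
      size (mset_sym_diff (colour_class i (E1 n d \<pi>))
        (image_mset (map_prod \<mu> \<mu>) (colour_class i (E1 n d \<pi>)))))
    \<ge> \<gamma> * real (card {v \<in> {1..n}. \<mu> v \<noteq> v})"
    by (simp only: D_def A_def)
qed

lemma expanding_underlying_E1:
  assumes exp: "expanding \<gamma> (V2 n) (E2 n d \<pi>)"
  shows "expanding \<gamma> {1..n} (underlying (E1 n d \<pi>))"
  unfolding expanding_def
proof (intro allI impI)
  fix S assume S: "S \<subseteq> {1..n}" and "real (card S) \<le> real (card {1..n}) / 2"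
  then have S2: "2 * card S \<le> n" by simp
  define N where "N = {v \<in> {1..n} - S. \<exists>u\<in>S. Upair u v \<in># underlying (E1 n d \<pi>)}"
  have "\<gamma> * real (card S) \<le> real (card N)"
  proof (cases "n \<ge> 2")
    case False
    then have "card S = 0" using S2 by linarith
    then show ?thesis by simp
  next
    case True
    define T where "T = (SIGMA u:S. {1..n} - {u})"
    define M where "M = {q \<in> V2 n - T. \<exists>p\<in>T. Upair p q \<in># E2 n d \<pi>}"
    have T: "T \<subseteq> V2 n" using S by (auto simp: T_def V2_def)
    have card_T: "card T = card S * (n - 1)"
      unfolding T_def by (rule card_Sigma_diff_single[OF S])
    have "2 * card T \<le> card (V2 n)"
      using mult_le_mono1[OF S2, of "n - 1"] by (simp add: card_T card_V2)
    then have "real (card T) \<le> real (card (V2 n)) / 2" by linarith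
    then have M: "\<gamma> * real (card T) \<le> real (card M)"
      using exp T unfolding expanding_def M_def by blast
    have "M \<subseteq> (SIGMA u:N. {1..n} - {u})"
    proof
      fix q assume q: "q \<in> M"
      obtain x y where xy: "q = (x, y)" by (cases q)
      from q xy have V: "x \<in> {1..n}" "y \<in> {1..n} - {x}" and "x \<notin> S"
        by (auto simp: M_def V2_def T_def)
      from q xy obtain u v where "u \<in> S" and e: "Upair (u, v) (x, y) \<in># E2 n d \<pi>"
        by (auto simp: M_def T_def)
      \<comment> \<open>Both coordinates move by the same \<open>\<pi> i\<close>, so first
        coordinates of adjacent pairs are adjacent.\<close>
      from e have "Upair u x \<in># underlying (E1 n d \<pi>)"
        unfolding Upair_in_E2_iff Upair_in_underlying_E1_iff by (auto simp: V2_def)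
      with \<open>u \<in> S\<close> \<open>x \<notin> S\<close> V show "q \<in> (SIGMA u:N. {1..n} - {u})"
        by (auto simp: N_def xy)
    qed
    then have "card M \<le> card (SIGMA u:N. {1..n} - {u})"
      by (rule card_mono[rotated]) (auto simp: N_def)
    also have "\<dots> = card N * (n - 1)"
      by (rule card_Sigma_diff_single) (auto simp: N_def)
    finally have "real (card M) \<le> real (card N) * real (n - 1)"
      by (metis of_nat_le_iff of_nat_mult)
    with M have "(\<gamma> * real (card S)) * real (n - 1) \<le> real (card N) * real (n - 1)"
      by (simp add: card_T mult.assoc)
    \<comment> \<open>The common fibre size \<open>n - 1\<close> is positive and cancels.\<close>
    then show ?thesis
      by (rule mult_right_le_imp_le) (use True in simp)
  qed
  then show "real (card {v \<in> {1..n} - S. \<exists>u\<in>S. Upair u v \<in># underlying (E1 n d \<pi>)}) \<ge> \<gamma> * real (card S)"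
    by (simp only: N_def)
qed

text \<open>Every graph is 0-expanding, as cardinalities are nonnegative. The \<open>max\<close>
  covers negative \<open>\<gamma>\<close>, where \<open>\<gamma> / 3\<close> exceeds
  \<open>\<gamma>\<close> but stays below 0.\<close>

lemma expanding_mono:
  assumes "expanding \<gamma> V E" and "\<delta> \<le> max 0 \<gamma>"
  shows "expanding \<delta> V E"
  unfolding expanding_def
proof (intro allI impI)
  fix S assume "S \<subseteq> V" "real (card S) \<le> real (card V) / 2"
  then have "\<gamma> * real (card S) \<le> real (card {v \<in> V - S. \<exists>u\<in>S. Upair u v \<in># E})"
    using assms(1) unfolding expanding_def by blast
  moreover have "\<delta> * real (card S) \<le> max 0 \<gamma> * real (card S)"
    using assms(2) by (rule mult_right_mono) simp
  ultimately show "\<delta> * real (card S) \<le> real (card {v \<in> V - S. \<exists>u\<in>S. Upair u v \<in># E})"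
    by (cases "\<gamma> \<ge> 0") (auto simp: max_def)
qed

theorem theorem3p2:
  fixes n d :: nat and \<pi> :: "nat \<Rightarrow> nat \<Rightarrow> nat" and \<gamma> :: real
  assumes "d \<ge> 2"
    and "\<And>i. i \<in> {1..d} \<Longrightarrow> \<pi> i permutes {1..n}"
    and "expanding \<gamma> (V2 n) (E2 n d \<pi>)"
  shows "(n \<noteq> 2 \<longrightarrow> robustly_self_ordered \<gamma> {1..n} (E1 n d \<pi>)) \<and>
         expanding (min 0.25 (\<gamma> / 3)) {1..n} (underlying (E1 n d \<pi>))"
proof
  show "n \<noteq> 2 \<longrightarrow> robustly_self_ordered \<gamma> {1..n} (E1 n d \<pi>)"
    using robustly_self_ordered_E1 assms(2,3) by blast
  show "expanding (min 0.25 (\<gamma> / 3)) {1..n} (underlying (E1 n d \<pi>))"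
    using expanding_underlying_E1[OF assms(3)] by (rule expanding_mono) linarith
qed

end
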